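(* Let $d_1,\dots,d_N\in\mathbb{R}^p$, let $\mathcal{T}\subset\mathbb{R}^p$ be a nonempty finite set, and let $1\le B\le N$ be an integer. Let $S_{\mathrm{greedy}}$ be the output of the greedy algorithm for $F(\cdot;\mathcal{T})$ under the constraint $|S|\le B$: starting from $\varnothing$, at each of $B$ steps it adds an index not yet chosen that gives the largest marginal increase of $F(\cdot;\mathcal{T})$. Then $$F(S_{\mathrm{greedy}};\mathcal{T})\ \ge\ (1-1/e)\,F(S^\star;\mathcal{T}),$$ where $S^\star$ maximizes $F(S;\mathcal{T})$ over all $S\subseteq[N]$ with $|S|\le B$.
   Context: $[N]=\{1,\dots,N\}$, $d_0:=0\in\mathbb{R}^p$ and $S_0:=S\cup\{0\}$ for $S\subseteq[N]$. The support coverage functional is $F(S;\mathcal{T}):=\frac{1}{|\mathcal{T}|}\sum_{s\in\mathcal{T}}\max_{i\in S_0}\langle d_i,s\rangle$. The marginal increase of index $i$ at a current set $S$ is $F(S\cup\{i\};\mathcal{T})-F(S;\mathcal{T})$; ties are broken arbitrarily. *)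

theory Defs
  imports "HOL-Analysis.Analysis"
begin

text \<open>The update \<open>d(0 := 0)\<close> implements the convention \<open>d\<^sub>0 := 0\<close>, and \<open>insert 0 S\<close> is \<open>S\<^sub>0\<close>;
  the value of \<open>d\<close> at index 0 is therefore irrelevant.\<close>

definition support_coverage ::
  "(nat \<Rightarrow> real ^ 'p) \<Rightarrow> (real ^ 'p) set \<Rightarrow> nat set \<Rightarrow> real" where
  "support_coverage d T S =
     1 / real (card T) * (\<Sum>s\<in>T. Max ((\<lambda>i. (d(0 := 0)) i \<bullet> s) ` insert 0 S))"

definition marginal_increase :: "(nat set \<Rightarrow> real) \<Rightarrow> nat set \<Rightarrow> nat \<Rightarrow> real" where
  "marginal_increase F S i = F (S \<union> {i}) - F S"

text \<open>\<open>greedy_output F N k S\<close>: some run of the greedy algorithm for \<open>F\<close> over the ground set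
  \<open>{1..N}\<close> has current set \<open>S\<close> after \<open>k\<close> steps. It is a relation, not a function, because ties
  are broken arbitrarily.\<close>

inductive greedy_output :: "(nat set \<Rightarrow> real) \<Rightarrow> nat \<Rightarrow> nat \<Rightarrow> nat set \<Rightarrow> bool"
  for F :: "nat set \<Rightarrow> real" and N :: nat where
  start: "greedy_output F N 0 {}"
| step: "greedy_output F N (Suc k) (S \<union> {i})"
    if "greedy_output F N k S"
      and "is_arg_max (marginal_increase F S) (\<lambda>j. j \<in> {1..N} - S) i"

end

theory Submission
  imports Defs
begin

text \<open>The coverage functional is monotone and has diminishing marginal increases, hence the
  largest marginal increase at \<open>S\<close> is at least a \<open>1/B\<close> fraction of the gap \<open>F S\<^sup>* - F S\<close>.  Each
  greedy step therefore shrinks the gap by the factor \<open>1 - 1/B\<close>, and \<open>(1 - 1/B)^B \<le> 1/e\<close>.\<close>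

text \<open>This isolates what the greedy argument needs from the coverage functional. Finiteness is
  imposed because \<open>Max\<close> is only meaningful on finite sets; it passes from
  \<open>S'\<close> to its subset \<open>S\<close>. Allowing \<open>i\<close> in \<open>S'\<close>
  is harmless: the increase there is 0, while the one at \<open>S\<close> is nonnegative by
  monotonicity.\<close>

definition monotone_submodular :: "(nat set \<Rightarrow> real) \<Rightarrow> bool" where
  "monotone_submodular F \<longleftrightarrow>
     (\<forall>S S'. finite S' \<longrightarrow> S \<subseteq> S' \<longrightarrow> F S \<le> F S') \<and>
     (\<forall>S S' i. finite S' \<longrightarrow> S \<subseteq> S' \<longrightarrow> marginal_increase F S' i \<le> marginal_increase F S i)"

lemma monotone_submodular_mono:
  "monotone_submodular F \<Longrightarrow> finite S' \<Longrightarrow> S \<subseteq> S' \<Longrightarrow> F S \<le> F S'"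
  by (simp add: monotone_submodular_def)

lemma monotone_submodular_marginal_antimono:
  "monotone_submodular F \<Longrightarrow> finite S' \<Longrightarrow> S \<subseteq> S' \<Longrightarrow>
    marginal_increase F S' i \<le> marginal_increase F S i"
  by (simp add: monotone_submodular_def)

text \<open>Add the elements of \<open>A\<close> one at a time: each increment is taken at a
  superset of \<open>S\<close>, so it is at most the increment at \<open>S\<close> itself, and the
  increments telescope.\<close>

lemma monotone_submodular_union_le_sum:
  assumes F: "monotone_submodular F" and "finite S" "finite A"
  shows "F (S \<union> A) - F S \<le> (\<Sum>j\<in>A. marginal_increase F S j)"
  using \<open>finite A\<close>
proof (induction A rule: finite_induct)
  case empty
  show ?case by simp
next
  case (insert a A)
  have "marginal_increase F (S \<union> A) a \<le> marginal_increase F S a"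
    using F insert.hyps \<open>finite S\<close> by (intro monotone_submodular_marginal_antimono) auto
  then have "F (S \<union> insert a A) - F (S \<union> A) \<le> marginal_increase F S a"
    by (simp add: marginal_increase_def)
  then show ?case
    using insert by simp
qed

lemma greedy_output_finite: "greedy_output F N k S \<Longrightarrow> finite S"
  by (induction rule: greedy_output.induct) auto

lemma greedy_step_gap:
  assumes F: "monotone_submodular F" and "finite S"
    and max: "is_arg_max (marginal_increase F S) (\<lambda>j. j \<in> {1..N} - S) i"
    and A: "A \<subseteq> {1..N}" "card A \<le> B" and "1 \<le> B"
  shows "F A - F (S \<union> {i}) \<le> (1 - 1 / real B) * (F A - F S)"
proof -
  let ?g = "marginal_increase F S i"
  have "finite A" using A(1) finite_subset by blast
  have g: "0 \<le> ?g"
    unfolding marginal_increase_def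
    using monotone_submodular_mono[OF F, of "S \<union> {i}" S] \<open>finite S\<close> by auto
  have "marginal_increase F S j \<le> ?g" if "j \<in> A" for j
  \<comment> \<open>Indices already in \<open>S\<close> are not candidates for the greedy choice,
    but their increase is 0, so \<open>g\<close> covers them as well.\<close>
  proof (cases "j \<in> S")
    case True
    then show ?thesis using g by (simp add: marginal_increase_def insert_absorb)
  next
    case False
    then show ?thesis using max that A(1) by (auto simp: is_arg_max_linorder)
  qed
  then have "(\<Sum>j\<in>A. marginal_increase F S j) \<le> real (card A) * ?g"
    by (intro sum_bounded_above)
  \<comment> \<open>\<open>A\<close> may have fewer than \<open>B\<close> elements; since
    \<open>?g\<close> is nonnegative, padding the count up to \<open>B\<close> only weakens the
    bound.\<close>
  also have "\<dots> \<le> real B * ?g"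
    using A(2) g by (intro mult_right_mono) auto
  finally have "F (S \<union> A) - F S \<le> real B * ?g"
    using monotone_submodular_union_le_sum[OF F \<open>finite S\<close> \<open>finite A\<close>] by linarith
  moreover have "F A \<le> F (S \<union> A)"
    using \<open>finite A\<close> \<open>finite S\<close> by (intro monotone_submodular_mono[OF F]) auto
  ultimately have "F A - F S \<le> real B * (F (S \<union> {i}) - F S)"
    by (simp add: marginal_increase_def)
  then show ?thesis
    using \<open>1 \<le> B\<close> by (simp add: field_simps)
qed

text \<open>The step count \<open>k\<close> is kept apart from the budget \<open>B\<close>, so that
  the induction over the run leaves the contraction factor fixed.\<close>

lemma greedy_output_gap:
  assumes "greedy_output F N k S" and F: "monotone_submodular F"
    and A: "A \<subseteq> {1..N}" "card A \<le> B" and "1 \<le> B"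
  shows "F A - F S \<le> (1 - 1 / real B) ^ k * (F A - F {})"
  using assms(1)
proof (induction rule: greedy_output.induct)
  case start
  show ?case by simp
next
  case (step k S i)
  have "F A - F (S \<union> {i}) \<le> (1 - 1 / real B) * (F A - F S)"
    using greedy_step_gap[OF F greedy_output_finite[OF step.hyps(1)] step.hyps(2) A \<open>1 \<le> B\<close>] .
  \<comment> \<open>The factor is nonnegative because \<open>B\<close> is at least 1, so multiplying
    the induction hypothesis by it keeps the inequality, whatever the sign of the gap.\<close>
  also have "\<dots> \<le> (1 - 1 / real B) * ((1 - 1 / real B) ^ k * (F A - F {}))"
    using step.IH \<open>1 \<le> B\<close> by (intro mult_left_mono) auto
  finally show ?case by (simp add: mult.assoc)
qed

theorem greedy_monotone_submodular:
  assumes F: "monotone_submodular F" and "F {} = 0"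
    and "greedy_output F N B S" and A: "A \<subseteq> {1..N}" "card A \<le> B" and "1 \<le> B"
  shows "(1 - 1 / exp 1) * F A \<le> F S"
proof -
  have "finite A" using A(1) finite_subset by blast
  then have nonneg: "0 \<le> F A"
    using monotone_submodular_mono[OF F, of A "{}"] \<open>F {} = 0\<close> by simp
  \<comment> \<open>This is 1 + x \<le> exp x at x = -1/B, raised to the power \<open>B\<close>; the
    base is nonnegative since \<open>B\<close> is at least 1.\<close>
  have "(1 - 1 / real B) ^ B \<le> exp (- 1 / real B) ^ B"
    using exp_ge_add_one_self[of "- 1 / real B"] \<open>1 \<le> B\<close> by (intro power_mono) auto
  also have "\<dots> = 1 / exp 1"
    using \<open>1 \<le> B\<close> by (simp flip: exp_of_nat_mult) (simp add: exp_minus inverse_eq_divide)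
  finally have "(1 - 1 / real B) ^ B * F A \<le> 1 / exp 1 * F A"
    using nonneg by (rule mult_right_mono)
  then show ?thesis
    using greedy_output_gap[OF assms(3) F A \<open>1 \<le> B\<close>] \<open>F {} = 0\<close> by (simp add: algebra_simps)
qed

lemma support_coverage_empty: "support_coverage d T {} = 0"
  by (simp add: support_coverage_def)

lemma support_coverage_mono:
  assumes "finite S'" "S \<subseteq> S'"
  shows "support_coverage d T S \<le> support_coverage d T S'"
  unfolding support_coverage_def
  using assms by (intro mult_left_mono sum_mono Max_mono image_mono) auto

text \<open>For a fixed direction \<open>s\<close>, adding a value v to a set with maximum m raises
  the maximum by max 0 (v - m). This decreases in m, and m grows with the set; averaging over
  \<open>T\<close> preserves the inequality.\<close>

lemma support_coverage_marginal_antimono: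
  assumes "finite S'" "S \<subseteq> S'"
  shows "marginal_increase (support_coverage d T) S' i
    \<le> marginal_increase (support_coverage d T) S i"
proof -
  let ?m = "\<lambda>s S. Max ((\<lambda>i. (d(0 := 0)) i \<bullet> s) ` insert 0 S)"
  have marg: "marginal_increase (support_coverage d T) S i
      = 1 / real (card T) * (\<Sum>s\<in>T. ?m s (S \<union> {i}) - ?m s S)" for S
    by (simp only: marginal_increase_def support_coverage_def sum_subtractf right_diff_distrib)
  have "?m s (S' \<union> {i}) - ?m s S' \<le> ?m s (S \<union> {i}) - ?m s S" for s
  proof -
    \<comment> \<open>The adjoined index 0 keeps the image nonempty even for empty \<open>R\<close>,
      as \<open>Max_insert\<close> requires.\<close>
    have ins: "?m s (R \<union> {i}) = max ((d(0 := 0)) i \<bullet> s) (?m s R)" if "finite R" for R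
    proof -
      have "(\<lambda>i. (d(0 := 0)) i \<bullet> s) ` insert 0 (R \<union> {i})
          = insert ((d(0 := 0)) i \<bullet> s) ((\<lambda>i. (d(0 := 0)) i \<bullet> s) ` insert 0 R)"
        by blast
      then show ?thesis
        using that by (simp only:) (rule Max_insert, auto)
    qed
    have "?m s S \<le> ?m s S'"
      using assms by (intro Max_mono image_mono) auto
    then show ?thesis
      unfolding ins[OF assms(1)] ins[OF finite_subset[OF assms(2,1)]] by linarith
  qed
  then show ?thesis
    unfolding marg by (intro mult_left_mono sum_mono) auto
qed

lemma monotone_submodular_support_coverage: "monotone_submodular (support_coverage d T)"
  by (simp add: monotone_submodular_def support_coverage_mono support_coverage_marginal_antimono)

theorem theorem4p5:
  fixes d :: "nat \<Rightarrow> real ^ 'p"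
    and T :: "(real ^ 'p) set"
    and N B :: nat
    and S_greedy S_star :: "nat set"
  assumes "finite T" and "T \<noteq> {}"
    and "1 \<le> B" and "B \<le> N"
    and "greedy_output (support_coverage d T) N B S_greedy"
    and "is_arg_max (support_coverage d T) (\<lambda>S. S \<subseteq> {1..N} \<and> card S \<le> B) S_star"
  shows "support_coverage d T S_greedy \<ge> (1 - 1 / exp 1) * support_coverage d T S_star"
  using greedy_monotone_submodular[OF monotone_submodular_support_coverage
      support_coverage_empty assms(5) _ _ assms(3)] assms(6)
  by (simp add: is_arg_max_def)

end
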